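(* Let $\mathcal{K}$ be a field with $\mathrm{Char}\,\mathcal{K}\neq 2$, let $\Gamma$ be a finite quiver without oriented cycles, let $\rho$ be a set of relations on $\Gamma$ over $\mathcal{K}$, and let $\Lambda=\mathcal{K}(\Gamma,\rho)$ be the (finite dimensional) path algebra over $\mathcal{K}$ of the quiver $(\Gamma,\rho)$ with relations. Then every Jordan derivation on $\Lambda$ is a derivation.
   Context: A quiver $\Gamma=(\Gamma_0,\Gamma_1)$ is an oriented graph with vertex set $\Gamma_0$ and arrow set $\Gamma_1$; it is finite if both sets are finite. An arrow $\alpha$ from $i$ to $j$ has $s(\alpha)=i$, $e(\alpha)=j$. A nontrivial path is an ordered sequence of arrows $p=\alpha_n\cdots\alpha_1$ ($n\ge 1$) with $e(\alpha_m)=s(\alpha_{m+1})$ for $1\le m<n$; $s(p)=s(\alpha_1)$, $e(p)=e(\alpha_n)$. For each vertex $i$ there is a trivial path $e_i$ with $s(e_i)=e(e_i)=i$. An oriented cycle is a nontrivial path $p$ with $s(p)=e(p)$. The path algebra $\mathcal{K}\Gamma$ has the set of all paths as $\mathcal{K}$-basis; the product $xy$ of two paths is their concatenation ($y$ first, then $x$) if $e(y)=s(x)$ and $0$ otherwise; its identity is $\sum_{i\in\Gamma_0}e_i$. A relation on $\Gamma$ over $\mathcal{K}$ is a $\mathcal{K}$-linear combination $\sum_i k_ip_i$ of paths with a common start vertex and a common end vertex, each path containing at least $2$ arrows. For a set $\rho$ of relations, $\mathcal{K}(\Gamma,\rho)=\mathcal{K}\Gamma/\langle\rho\rangle$, where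 $\langle\rho\rangle$ is the two-sided ideal generated by $\rho$. For a $\mathcal{K}$-algebra $\mathcal{A}$ write $a\circ b=ab+ba$. A $\mathcal{K}$-linear map $\Theta:\mathcal{A}\to\mathcal{A}$ is a derivation if $\Theta(ab)=\Theta(a)b+a\Theta(b)$ for all $a,b\in\mathcal{A}$, and a Jordan derivation if $\Theta(a\circ b)=\Theta(a)\circ b+a\circ\Theta(b)$ for all $a,b\in\mathcal{A}$. *)

theory Defs
  imports
    "HOL-Algebra.QuotRing"
    "HOL-Algebra.Module"
    "HOL-Library.Poly_Mapping"
    "Graph_Theory.Arc_Walk"
begin

section \<open>Quivers and paths\<close>

text \<open>
  A quiver is a \<^typ>\<open>('v, 'e) pre_digraph\<close> satisfying \<^locale>\<open>wf_digraph\<close> (multiple arrows and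
  loops are allowed), and a finite quiver is a \<^locale>\<open>fin_digraph\<close>; \<open>tail\<close> and \<open>head\<close> are
  \<open>s\<close> and \<open>e\<close>. A path is recorded as \<open>(start, arrows, end)\<close>, the trivial path at \<open>i\<close>
  being \<open>(i, [], i)\<close>. Arrows are listed in the order in which they are traversed, so the
  path \<open>\<alpha>\<^sub>n \<cdots> \<alpha>\<^sub>1\<close> has arrow list \<open>[\<alpha>\<^sub>1, \<dots>, \<alpha>\<^sub>n]\<close>.
\<close>

type_synonym ('v, 'e) qpath = "'v \<times> 'e awalk \<times> 'v"

definition path_start :: "('v, 'e) qpath \<Rightarrow> 'v" where
  "path_start p = fst p"

definition path_arrows :: "('v, 'e) qpath \<Rightarrow> 'e list" where
  "path_arrows p = fst (snd p)"

definition path_end :: "('v, 'e) qpath \<Rightarrow> 'v" where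
  "path_end p = snd (snd p)"

definition trivial_path :: "'v \<Rightarrow> ('v, 'e) qpath" where
  "trivial_path i = (i, [], i)"

definition qpaths :: "('v, 'e) pre_digraph \<Rightarrow> ('v, 'e) qpath set" where
  "qpaths \<Gamma> = {p. pre_digraph.awalk \<Gamma> (path_start p) (path_arrows p) (path_end p)}"

definition oriented_cycle :: "('v, 'e) pre_digraph \<Rightarrow> ('v, 'e) qpath \<Rightarrow> bool" where
  "oriented_cycle \<Gamma> p \<longleftrightarrow> p \<in> qpaths \<Gamma> \<and> path_arrows p \<noteq> [] \<and> path_start p = path_end p"

text \<open>The concatenation \<open>p q\<close> traverses \<open>q\<close> first; it is only used if \<open>q\<close> ends where \<open>p\<close> starts.\<close>

definition path_concat :: "('v, 'e) qpath \<Rightarrow> ('v, 'e) qpath \<Rightarrow> ('v, 'e) qpath" where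
  "path_concat p q = (path_start q, path_arrows q @ path_arrows p, path_end p)"


section \<open>Path algebras\<close>

text \<open>
  The field of scalars is the type \<^typ>\<open>'k\<close>. An algebra over it is a \<^typ>\<open>('k, 'a) module\<close>
  record, whose multiplication need not be commutative. Elements of the path algebra are finitely
  supported functions from paths to \<^typ>\<open>'k\<close>, and the product of paths is extended bilinearly.
  The identity is meaningful only if there are finitely many vertices.
\<close>

definition path_algebra_mult ::
    "(('v, 'e) qpath \<Rightarrow>\<^sub>0 'k::field) \<Rightarrow> (('v, 'e) qpath \<Rightarrow>\<^sub>0 'k) \<Rightarrow> (('v, 'e) qpath \<Rightarrow>\<^sub>0 'k)" where
  "path_algebra_mult x y =
    (\<Sum>p\<in>Poly_Mapping.keys x. \<Sum>q\<in>Poly_Mapping.keys y.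
      if path_end q = path_start p
      then Poly_Mapping.single (path_concat p q)
             (Poly_Mapping.lookup x p * Poly_Mapping.lookup y q)
      else 0)"

definition path_algebra ::
    "('v, 'e) pre_digraph \<Rightarrow> ('k::field, ('v, 'e) qpath \<Rightarrow>\<^sub>0 'k) module" where
  "path_algebra \<Gamma> =
    \<lparr>carrier = {x. Poly_Mapping.keys x \<subseteq> qpaths \<Gamma>},
     mult = path_algebra_mult,
     one = (\<Sum>i\<in>verts \<Gamma>. Poly_Mapping.single (trivial_path i) 1),
     zero = 0,
     add = (+),
     smult = (\<lambda>k. Poly_Mapping.map ((*) k))\<rparr>"

definition quiver_relation ::
    "('v, 'e) pre_digraph \<Rightarrow> (('v, 'e) qpath \<Rightarrow>\<^sub>0 'k::field) \<Rightarrow> bool" where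
  "quiver_relation \<Gamma> r \<longleftrightarrow>
    r \<in> carrier (path_algebra \<Gamma>) \<and>
    (\<exists>u v. \<forall>p\<in>Poly_Mapping.keys r.
      path_start p = u \<and> path_end p = v \<and> 2 \<le> length (path_arrows p))"

text \<open>
  The library quotient \<open>A Quot I\<close> by a two-sided ideal carries only the ring structure. It is
  extended here by the induced action \<open>k (I + x) = I + k x\<close>, written as a union over
  representatives in the style of \<^const>\<open>rcoset_mult\<close>.
\<close>

definition quotient_algebra :: "('k, 'a) module \<Rightarrow> 'a set \<Rightarrow> ('k, 'a set) module" where
  "quotient_algebra A I =
    ring.extend (A Quot I) (module.fields (\<lambda>k X. \<Union>x\<in>X. I +>\<^bsub>A\<^esub> (k \<odot>\<^bsub>A\<^esub> x)))"

definition path_algebra_relations ::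
    "('v, 'e) pre_digraph \<Rightarrow> (('v, 'e) qpath \<Rightarrow>\<^sub>0 'k::field) set
      \<Rightarrow> ('k, (('v, 'e) qpath \<Rightarrow>\<^sub>0 'k) set) module" where
  "path_algebra_relations \<Gamma> \<rho> =
    quotient_algebra (path_algebra \<Gamma>) (Idl\<^bsub>path_algebra \<Gamma>\<^esub> \<rho>)"


section \<open>Derivations and Jordan derivations\<close>

definition linear_endo :: "('k, 'a) module \<Rightarrow> ('a \<Rightarrow> 'a) \<Rightarrow> bool" where
  "linear_endo A \<Theta> \<longleftrightarrow>
    \<Theta> \<in> carrier A \<rightarrow> carrier A \<and>
    (\<forall>a\<in>carrier A. \<forall>b\<in>carrier A. \<Theta> (a \<oplus>\<^bsub>A\<^esub> b) = \<Theta> a \<oplus>\<^bsub>A\<^esub> \<Theta> b) \<and>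
    (\<forall>k. \<forall>a\<in>carrier A. \<Theta> (k \<odot>\<^bsub>A\<^esub> a) = k \<odot>\<^bsub>A\<^esub> \<Theta> a)"

definition derivation :: "('k, 'a) module \<Rightarrow> ('a \<Rightarrow> 'a) \<Rightarrow> bool" where
  "derivation A \<Theta> \<longleftrightarrow>
    linear_endo A \<Theta> \<and>
    (\<forall>a\<in>carrier A. \<forall>b\<in>carrier A.
      \<Theta> (a \<otimes>\<^bsub>A\<^esub> b) = \<Theta> a \<otimes>\<^bsub>A\<^esub> b \<oplus>\<^bsub>A\<^esub> a \<otimes>\<^bsub>A\<^esub> \<Theta> b)"

definition jordan_product :: "('k, 'a) module \<Rightarrow> 'a \<Rightarrow> 'a \<Rightarrow> 'a" where
  "jordan_product A a b = a \<otimes>\<^bsub>A\<^esub> b \<oplus>\<^bsub>A\<^esub> b \<otimes>\<^bsub>A\<^esub> a"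

definition jordan_derivation :: "('k, 'a) module \<Rightarrow> ('a \<Rightarrow> 'a) \<Rightarrow> bool" where
  "jordan_derivation A \<Theta> \<longleftrightarrow>
    linear_endo A \<Theta> \<and>
    (\<forall>a\<in>carrier A. \<forall>b\<in>carrier A.
      \<Theta> (jordan_product A a b) = jordan_product A (\<Theta> a) b \<oplus>\<^bsub>A\<^esub> jordan_product A a (\<Theta> b))"

end

theory Submission
  imports Defs
begin

text \<open>
  Let \<open>e\<^sub>i\<close> be the idempotent of the trivial path at \<open>i\<close>. Since there are no oriented cycles,
  \<open>e\<^sub>i \<Lambda> e\<^sub>i\<close> consists of multiples of \<open>e\<^sub>i\<close>, and for \<open>i \<noteq> j\<close> one of \<open>e\<^sub>i \<Lambda> e\<^sub>j\<close>, \<open>e\<^sub>j \<Lambda> e\<^sub>i\<close>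
  vanishes; both properties pass to quotients. Given a Jordan derivation \<open>\<Theta>\<close>, subtracting the
  inner derivation of \<open>d = \<Sum>\<^sub>i \<Theta>(e\<^sub>i) e\<^sub>i\<close> makes it vanish on every \<open>e\<^sub>i\<close>. It then maps each
  \<open>e\<^sub>i \<Lambda> e\<^sub>j\<close> into itself. For Peirce components \<open>x\<close>, \<open>y\<close>, unless one of them is zero or a multiple
  of some \<open>e\<^sub>i\<close>, at least one of \<open>x y\<close> and \<open>y x\<close> vanishes for reasons that also apply to
  \<open>\<Theta>(x)\<close>, \<open>\<Theta>(y)\<close>, so the Jordan identity reduces to the Leibniz rule.
\<close>

section \<open>Jordan derivations of triangular algebras\<close>

text \<open>Scalars range over the whole type \<open>'k\<close>, so the axioms restrict only the
  vectors to the carrier. The multiplication may be noncommutative, hence scalars must be movable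
  out of either factor.\<close>

locale field_algebra = ring A for A :: "('k::field, 'a) module" (structure) +
  assumes smult_closed [simp, intro]: "x \<in> carrier A \<Longrightarrow> k \<odot> x \<in> carrier A"
    and smult_l_distr: "x \<in> carrier A \<Longrightarrow> (k + l) \<odot> x = k \<odot> x \<oplus> l \<odot> x"
    and smult_r_distr:
      "\<lbrakk>x \<in> carrier A; y \<in> carrier A\<rbrakk> \<Longrightarrow> k \<odot> (x \<oplus> y) = k \<odot> x \<oplus> k \<odot> y"
    and smult_assoc: "x \<in> carrier A \<Longrightarrow> (k * l) \<odot> x = k \<odot> (l \<odot> x)"
    and smult_one [simp]: "x \<in> carrier A \<Longrightarrow> 1 \<odot> x = x"
    and smult_mult_left:
      "\<lbrakk>x \<in> carrier A; y \<in> carrier A\<rbrakk> \<Longrightarrow> (k \<odot> x) \<otimes> y = k \<odot> (x \<otimes> y)"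
    and smult_mult_right:
      "\<lbrakk>x \<in> carrier A; y \<in> carrier A\<rbrakk> \<Longrightarrow> x \<otimes> (k \<odot> y) = k \<odot> (x \<otimes> y)"
begin

lemma smult_zero [simp]: "k \<odot> \<zero> = \<zero>"
proof -
  have "k \<odot> \<zero> = k \<odot> (\<zero> \<otimes> \<zero>)"
    by simp
  also have "\<dots> = \<zero> \<otimes> (k \<odot> \<zero>)"
    by (rule smult_mult_right [symmetric]) simp_all
  finally show ?thesis
    by simp
qed

text \<open>The characteristic enters the argument here: once 2 is invertible, every
  \<open>z\<close> is recovered from \<open>z \<oplus> z\<close> by halving.\<close>

lemma double_inject:
  assumes "(2::'k) \<noteq> 0" and xy: "x \<in> carrier A" "y \<in> carrier A" and "x \<oplus> x = y \<oplus> y"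
  shows "x = y"
proof -
  have "1/2 + 1/2 = 2 * (1/2 :: 'k)"
    by (simp only: mult_2)
  also have "\<dots> = 1"
    using assms(1) by simp
  finally have half: "1/2 + 1/2 = (1 :: 'k)" .
  have *: "z = (1/2) \<odot> (z \<oplus> z)" if "z \<in> carrier A" for z
    using smult_l_distr [OF that, of "1/2" "1/2"] that unfolding half by (simp add: smult_r_distr)
  show ?thesis
    using * [OF xy(1)] * [OF xy(2)] assms(4) by simp
qed

end

lemma (in ring) add_self_imp_zero:
  assumes "x \<in> carrier R" and "x \<oplus> x = x"
  shows "x = \<zero>"
  using assms by (metis add.r_cancel_one')

locale jordan_map = field_algebra A for A :: "('k::field, 'a) module" (structure) +
  fixes \<Theta> :: "'a \<Rightarrow> 'a"
  assumes jordan: "jordan_derivation A \<Theta>"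
begin

lemma Theta_closed [simp, intro]: "x \<in> carrier A \<Longrightarrow> \<Theta> x \<in> carrier A"
  and Theta_add: "\<lbrakk>x \<in> carrier A; y \<in> carrier A\<rbrakk> \<Longrightarrow> \<Theta> (x \<oplus> y) = \<Theta> x \<oplus> \<Theta> y"
  and Theta_smult: "x \<in> carrier A \<Longrightarrow> \<Theta> (k \<odot> x) = k \<odot> \<Theta> x"
  and Theta_jordan: "\<lbrakk>x \<in> carrier A; y \<in> carrier A\<rbrakk> \<Longrightarrow>
    \<Theta> (x \<otimes> y \<oplus> y \<otimes> x) = \<Theta> x \<otimes> y \<oplus> y \<otimes> \<Theta> x \<oplus> (x \<otimes> \<Theta> y \<oplus> \<Theta> y \<otimes> x)"
  using jordan
  by (auto simp: jordan_derivation_def linear_endo_def jordan_product_def)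

lemma Theta_zero [simp]: "\<Theta> \<zero> = \<zero>"
  by (rule add_self_imp_zero) (simp_all flip: Theta_add)

end

text \<open>Abstracts what acyclicity gives. As \<open>x\<close> and \<open>y\<close> vary
  independently, \<open>triangular\<close> says that one of the two opposite off-diagonal components
  is zero altogether. All axioms are identities on elements, which makes them stable under
  quotients.\<close>

locale triangular_algebra = field_algebra A for A :: "('k::field, 'a) module" (structure) +
  fixes I :: "'i set" and e :: "'i \<Rightarrow> 'a"
  assumes finite_I: "finite I"
    and e_closed [simp]: "i \<in> I \<Longrightarrow> e i \<in> carrier A"
    and e_mult: "\<lbrakk>i \<in> I; j \<in> I\<rbrakk> \<Longrightarrow> e i \<otimes> e j = (if i = j then e i else \<zero>)"
    and sum_e: "(\<Oplus>i\<in>I. e i) = \<one>"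
    and corner: "\<lbrakk>i \<in> I; x \<in> carrier A\<rbrakk> \<Longrightarrow> \<exists>k. e i \<otimes> x \<otimes> e i = k \<odot> e i"
    and triangular: "\<lbrakk>i \<in> I; j \<in> I; i \<noteq> j; x \<in> carrier A; y \<in> carrier A\<rbrakk> \<Longrightarrow>
      e i \<otimes> x \<otimes> e j = \<zero> \<or> e j \<otimes> y \<otimes> e i = \<zero>"
begin

section \<open>Peirce decomposition\<close>

definition peirce :: "'i \<Rightarrow> 'i \<Rightarrow> 'a set" where
  "peirce i j = {x \<in> carrier A. e i \<otimes> x = x \<and> x \<otimes> e j = x}"

lemma peirceI: "\<lbrakk>i \<in> I; j \<in> I; x \<in> carrier A\<rbrakk> \<Longrightarrow> e i \<otimes> x \<otimes> e j \<in> peirce i j"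
  by (simp add: peirce_def m_assoc e_mult) (simp add: e_mult flip: m_assoc)

lemma peirceD:
  assumes "x \<in> peirce i j"
  shows "x \<in> carrier A" "e i \<otimes> x = x" "x \<otimes> e j = x"
  using assms by (simp_all add: peirce_def)

lemma peirce_mult_zero:
  assumes "i \<in> I" "j \<in> I" "j' \<in> I" "l \<in> I" "j \<noteq> j'" "x \<in> peirce i j" "y \<in> peirce j' l"
  shows "x \<otimes> y = \<zero>"
proof -
  have "x \<otimes> y = (x \<otimes> e j) \<otimes> (e j' \<otimes> y)"
    using assms by (simp add: peirceD)
  also have "\<dots> = x \<otimes> (e j \<otimes> e j') \<otimes> y"
    using assms by (simp add: peirceD(1) m_assoc)
  finally show ?thesis
    using assms by (simp add: peirceD(1) e_mult)
qed

lemma peirce_diag: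
  assumes "i \<in> I" "x \<in> peirce i i"
  obtains k where "x = k \<odot> e i"
  using corner [of i x] peirceD [OF assms(2)] assms(1) by auto

lemma peirce_triangular:
  assumes "i \<in> I" "j \<in> I" "i \<noteq> j" "x \<in> peirce i j" "y \<in> peirce j i"
  shows "x = \<zero> \<or> y = \<zero>"
  using triangular [OF assms(1-3), of x y] assms peirceD [OF assms(4)] peirceD [OF assms(5)]
  by simp

lemma sum_right_e: "x \<in> carrier A \<Longrightarrow> (\<Oplus>i\<in>I. x \<otimes> e i) = x"
  using finsum_rdistr [OF finite_I, of x e] by (simp add: sum_e Pi_def)

lemma sum_left_e: "x \<in> carrier A \<Longrightarrow> (\<Oplus>i\<in>I. e i \<otimes> x) = x"
  using finsum_ldistr [OF finite_I, of x e] by (simp add: sum_e Pi_def)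

text \<open>Since the idempotents sum to \<open>\<one>\<close>, each \<open>x\<close> is the double
  sum of its components \<open>e i \<otimes> x \<otimes> e j\<close>. A property stable under sums
  therefore needs checking only on Peirce components.\<close>

lemma additive_induct [consumes 1, case_names add zero peirce]:
  assumes x: "x \<in> carrier A"
    and P_add: "\<And>x y. \<lbrakk>x \<in> carrier A; y \<in> carrier A; P x; P y\<rbrakk> \<Longrightarrow> P (x \<oplus> y)"
    and P_zero: "P \<zero>"
    and P_peirce: "\<And>i j x. \<lbrakk>i \<in> I; j \<in> I; x \<in> peirce i j\<rbrakk> \<Longrightarrow> P x"
  shows "P x"
proof -
  have P_sum: "P (\<Oplus>i\<in>I. f i)"
    if f: "\<And>i. i \<in> I \<Longrightarrow> f i \<in> carrier A \<and> P (f i)" for f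
  proof -
    have "J \<subseteq> I \<Longrightarrow> (\<Oplus>i\<in>J. f i) \<in> carrier A \<and> P (\<Oplus>i\<in>J. f i)" if "finite J" for J
      using \<open>finite J\<close>
    proof (induction J)
      case empty
      show ?case by (simp add: P_zero)
    next
      case (insert i J)
      then have "f \<in> J \<rightarrow> carrier A" "f i \<in> carrier A" "P (f i)"
        using f by auto
      then show ?case
        using insert by (simp add: P_add)
    qed
    then show ?thesis using finite_I by blast
  qed
  have "P (e i \<otimes> x)" if "i \<in> I" for i
    using P_sum [of "\<lambda>j. e i \<otimes> x \<otimes> e j"] that x
    by (simp add: sum_right_e P_peirce [OF _ _ peirceI])
  then show ?thesis
    using P_sum [of "\<lambda>i. e i \<otimes> x"] x by (simp add: sum_left_e)
qed

end

section \<open>Jordan derivations of a triangular algebra\<close>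

locale triangular_jordan_map = triangular_algebra A I e + jordan_map A \<Theta>
  for A :: "('k::field, 'a) module" (structure) and I :: "'i set" and e and \<Theta>
begin

text \<open>Diagonal elements are multiples of \<open>e i\<close>, so their image is zero. For
  \<open>i \<noteq> j\<close>, the Jordan identity for \<open>x\<close> with \<open>e i\<close> and
  with \<open>e j\<close> expresses \<open>\<Theta> x\<close> in two ways; comparing them leaves
  only the component at \<open>(i, j)\<close>.\<close>

lemma Theta_peirce:
  assumes kill: "\<And>i. i \<in> I \<Longrightarrow> \<Theta> (e i) = \<zero>"
    and ij: "i \<in> I" "j \<in> I" and x: "x \<in> peirce i j"
  shows "\<Theta> x \<in> peirce i j"
proof -
  note xc [simp] = peirceD [OF x]
  consider "i = j" | "x = \<zero>" | "i \<noteq> j" "x \<noteq> \<zero>" by blast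
  then show ?thesis
  proof cases
    case 1
    then obtain k where "x = k \<odot> e i"
      using peirce_diag ij x by blast
    then have "\<Theta> x = \<zero>"
      using ij kill by (simp add: Theta_smult)
    then show ?thesis
      using ij by (simp add: peirce_def)
  next
    case 2
    then show ?thesis
      using ij by (simp add: peirce_def)
  next
    case 3
    let ?y = "\<Theta> x"
    have xi: "x \<otimes> e i = \<zero>" and jx: "e j \<otimes> x = \<zero>"
      using peirce_mult_zero [of i j i i x "e i"] peirce_mult_zero [of j j i j "e j" x] 3 ij x
      by (simp_all add: peirce_def e_mult)
    have yi: "?y = e i \<otimes> ?y \<oplus> ?y \<otimes> e i"
      using Theta_jordan [of "e i" x] ij xi kill by simp
    have yj: "?y = e j \<otimes> ?y \<oplus> ?y \<otimes> e j"
      using Theta_jordan [of "e j" x] ij jx kill by simp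
    \<comment> \<open>A nonzero \<open>x\<close> in the component at \<open>(i, j)\<close> forces
      the opposite component to vanish.\<close>
    have ji: "e j \<otimes> ?y \<otimes> e i = \<zero>"
      using triangular [of i j x ?y] 3 ij by auto
    have "e j \<otimes> ?y = e j \<otimes> (e i \<otimes> ?y \<oplus> ?y \<otimes> e i)"
      using yi by simp
    also have "\<dots> = (e j \<otimes> e i) \<otimes> ?y \<oplus> e j \<otimes> ?y \<otimes> e i"
      using ij by (simp add: r_distr m_assoc)
    also have "\<dots> = \<zero>"
      using ji ij 3 by (simp add: e_mult)
    finally have y1: "?y \<otimes> e j = ?y"
      using yj ij by simp
    have "?y \<otimes> e i = ?y \<otimes> e j \<otimes> e i"
      using y1 by simp
    also have "\<dots> = \<zero>"
      using ij 3 by (simp add: m_assoc e_mult)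
    finally have "e i \<otimes> ?y = ?y"
      using yi ij by simp
    with y1 show ?thesis
      by (simp add: peirce_def)
  qed
qed

text \<open>Both sides are additive in \<open>x\<close> and in \<open>y\<close>, so it suffices to
  treat Peirce components, each of which \<open>\<Theta>\<close> preserves.\<close>

lemma derivation_of_kill_idempotents:
  assumes kill: "\<And>i. i \<in> I \<Longrightarrow> \<Theta> (e i) = \<zero>"
    and "x \<in> carrier A" "y \<in> carrier A"
  shows "\<Theta> (x \<otimes> y) = \<Theta> x \<otimes> y \<oplus> x \<otimes> \<Theta> y"
proof -
  have *: "\<Theta> (x \<otimes> y) = \<Theta> x \<otimes> y \<oplus> x \<otimes> \<Theta> y"
    if ij: "i \<in> I" "j \<in> I" and kl: "k \<in> I" "l \<in> I"
      and x: "x \<in> peirce i j" and y: "y \<in> peirce k l" for i j k l x y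
  proof -
    note xc [simp] = peirceD [OF x]
    note yc [simp] = peirceD [OF y]
    note tx = Theta_peirce [OF kill ij x]
    note ty = Theta_peirce [OF kill kl y]
    note [simp] = peirceD [OF tx] peirceD [OF ty]
    \<comment> \<open>The cases are exhaustive: if \<open>j = k\<close>, \<open>i \<noteq> j\<close>
      and \<open>l = i\<close>, then \<open>x\<close> and \<open>y\<close> lie in opposite
      off-diagonal components, and triangularity makes one of them zero.\<close>
    consider "x = \<zero> \<or> y = \<zero>" | "j \<noteq> k" | "j = k" "i = j" | "j = k" "k = l"
      | "j = k" "i \<noteq> j" "k \<noteq> l" "l \<noteq> i"
      using peirce_triangular [OF ij _ x, of y] y by blast
    then show ?thesis
    proof cases
      case 1
      then show ?thesis by auto
    next
      case 2
      have "x \<otimes> y = \<zero>" "\<Theta> x \<otimes> y = \<zero>" "x \<otimes> \<Theta> y = \<zero>"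
        using peirce_mult_zero [OF ij kl 2] x y tx ty by auto
      then show ?thesis by simp
    next
      case 3
      then obtain c where c: "x = c \<odot> e i"
        using peirce_diag ij x by blast
      have "\<Theta> x = \<zero>" "x \<otimes> y = c \<odot> y" "x \<otimes> \<Theta> y = c \<odot> \<Theta> y"
        using 3 ij kill unfolding c by (simp_all add: Theta_smult smult_mult_left)
      then show ?thesis by (simp add: Theta_smult)
    next
      case 4
      then obtain c where c: "y = c \<odot> e k"
        using peirce_diag kl y by blast
      have "x \<otimes> e k = x" "\<Theta> x \<otimes> e k = \<Theta> x"
        using peirceD(3) [OF x] peirceD(3) [OF tx] 4 by simp_all
      then have "\<Theta> y = \<zero>" "x \<otimes> y = c \<odot> x" "\<Theta> x \<otimes> y = c \<odot> \<Theta> x"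
        using kl kill unfolding c by (simp_all add: Theta_smult smult_mult_right)
      then show ?thesis by (simp add: Theta_smult)
    next
      case 5
      \<comment> \<open>As \<open>l \<noteq> i\<close>, every product in the reverse order vanishes,
        and what remains of the Jordan identity is the Leibniz rule.\<close>
      have "y \<otimes> x = \<zero>" "y \<otimes> \<Theta> x = \<zero>" "\<Theta> y \<otimes> x = \<zero>"
        using peirce_mult_zero [OF kl ij \<open>l \<noteq> i\<close>] x y tx ty by auto
      then show ?thesis
        using Theta_jordan [of x y] by simp
    qed
  qed
  have **: "\<Theta> (x \<otimes> y) = \<Theta> x \<otimes> y \<oplus> x \<otimes> \<Theta> y"
    if "i \<in> I" "j \<in> I" "x \<in> peirce i j" "y \<in> carrier A" for i j x y
    using \<open>y \<in> carrier A\<close>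
  proof (induction rule: additive_induct)
    case (add y y')
    then show ?case
      using peirceD(1) [OF that(3)] by (simp add: r_distr Theta_add a_ac)
  qed (use that * peirceD in auto)
  show ?thesis
    using \<open>x \<in> carrier A\<close>
  proof (induction rule: additive_induct)
    case (add x x')
    then show ?case
      using \<open>y \<in> carrier A\<close> by (simp add: l_distr Theta_add a_ac)
  qed (use assms ** in auto)
qed

text \<open>Apply \<open>\<Theta>\<close> to the Jordan square of \<open>e i\<close>, which is
  \<open>e i \<oplus> e i\<close>, and halve. Multiplying the result by \<open>e i\<close> on both
  sides gives \<open>z = z \<oplus> z\<close> for
  \<open>z = e i \<otimes> \<Theta> (e i) \<otimes> e i\<close>.\<close>

lemma idempotent_sum:
  assumes "(2::'k) \<noteq> 0" "i \<in> I"
  shows "\<Theta> (e i) = \<Theta> (e i) \<otimes> e i \<oplus> e i \<otimes> \<Theta> (e i)" and "e i \<otimes> \<Theta> (e i) \<otimes> e i = \<zero>"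
proof -
  let ?e = "e i" and ?y = "\<Theta> (e i)"
  have cl [simp]: "?e \<in> carrier A" "?y \<in> carrier A" and ee: "?e \<otimes> ?e = ?e"
    using assms by (simp_all add: e_mult)
  have 2: "?y \<oplus> ?y = (?y \<otimes> ?e \<oplus> ?e \<otimes> ?y) \<oplus> (?y \<otimes> ?e \<oplus> ?e \<otimes> ?y)"
    using Theta_jordan [of ?e ?e] by (simp add: ee Theta_add a_ac)
  show 1: "?y = ?y \<otimes> ?e \<oplus> ?e \<otimes> ?y"
    by (rule double_inject [OF assms(1) _ _ 2]) simp_all
  have "?e \<otimes> ?y \<otimes> ?e = ?e \<otimes> (?y \<otimes> ?e \<oplus> ?e \<otimes> ?y) \<otimes> ?e"
    using 1 by simp
  also have "\<dots> = ?e \<otimes> ?y \<otimes> (?e \<otimes> ?e) \<oplus> (?e \<otimes> ?e) \<otimes> ?y \<otimes> ?e"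
    by (simp add: l_distr r_distr m_assoc)
  finally show "?e \<otimes> ?y \<otimes> ?e = \<zero>"
    using add_self_imp_zero [of "?e \<otimes> ?y \<otimes> ?e"] by (simp add: ee)
qed

text \<open>Supplies the inner correction. With \<open>d\<close> the sum of the
  \<open>\<Theta> (e i) \<otimes> e i\<close>, orthogonality gives
  \<open>d \<otimes> e j = \<Theta> (e j) \<otimes> e j\<close>, and the Jordan identities give
  \<open>e j \<otimes> d = \<ominus> (e j \<otimes> \<Theta> (e j))\<close>. Hence
  \<open>\<Theta> (e j)\<close> is the commutator of \<open>d\<close> and
  \<open>e j\<close>.\<close>

lemma ex_commutator:
  assumes "(2::'k) \<noteq> 0"
  obtains d f where "d \<in> carrier A" "f \<in> carrier A" "d \<oplus> f = \<zero>"
    "\<And>j. j \<in> I \<Longrightarrow> \<Theta> (e j) \<oplus> (e j \<otimes> d \<oplus> f \<otimes> e j) = \<zero>"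
proof
  let ?d = "\<Oplus>i\<in>I. \<Theta> (e i) \<otimes> e i"
  let ?f = "\<ominus> ?d"
  show d: "?d \<in> carrier A" and f: "?f \<in> carrier A" and df: "?d \<oplus> ?f = \<zero>"
    by (auto simp: r_neg)
  fix j assume j: "j \<in> I"
  have 1: "?d \<otimes> e j = \<Theta> (e j) \<otimes> e j"
  proof -
    have "?d \<otimes> e j = (\<Oplus>i\<in>I. if j = i then \<Theta> (e i) \<otimes> e i else \<zero>)"
      using j by (auto simp: finsum_ldistr [OF finite_I] Pi_def m_assoc e_mult intro!: finsum_cong')
    also have "\<dots> = \<Theta> (e j) \<otimes> e j"
      using j finite_I by (intro add.finprod_singleton) auto
    finally show ?thesis .
  qed
  \<comment> \<open>For \<open>i \<noteq> j\<close> the Jordan product of \<open>e i\<close> and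
    \<open>e j\<close> is zero; its image under \<open>\<Theta>\<close>, multiplied by
    \<open>e j\<close> on the left and by \<open>e i\<close> on the right, leaves exactly these two
    terms. For \<open>i = j\<close> both terms are zero.\<close>
  have "e j \<otimes> (\<Theta> (e i) \<otimes> e i) \<oplus> e j \<otimes> \<Theta> (e j) \<otimes> e i = \<zero>" if i: "i \<in> I" for i
  proof (cases "i = j")
    case True
    then show ?thesis
      using idempotent_sum(2) [OF assms j] j by (simp add: m_assoc)
  next
    case False
    let ?y = "\<Theta> (e i)" and ?z = "\<Theta> (e j)"
    have cl: "e i \<in> carrier A" "e j \<in> carrier A" "?y \<in> carrier A" "?z \<in> carrier A"
      using i j by simp_all
    have "?y \<otimes> e j \<oplus> e j \<otimes> ?y \<oplus> (e i \<otimes> ?z \<oplus> ?z \<otimes> e i) = \<zero>"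
      using Theta_jordan [of "e i" "e j"] i j False by (simp add: e_mult)
    then have "e j \<otimes> (?y \<otimes> e j \<oplus> e j \<otimes> ?y \<oplus> (e i \<otimes> ?z \<oplus> ?z \<otimes> e i)) \<otimes> e i = \<zero>"
      using cl by simp
    moreover have "e j \<otimes> (?y \<otimes> e j \<oplus> e j \<otimes> ?y \<oplus> (e i \<otimes> ?z \<oplus> ?z \<otimes> e i)) \<otimes> e i
      = e j \<otimes> ?y \<otimes> (e j \<otimes> e i) \<oplus> (e j \<otimes> e j) \<otimes> ?y \<otimes> e i
        \<oplus> ((e j \<otimes> e i) \<otimes> ?z \<otimes> e i \<oplus> e j \<otimes> ?z \<otimes> (e i \<otimes> e i))"
      using cl by (simp add: l_distr r_distr m_assoc)
    ultimately show ?thesis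
      using i j False by (simp add: e_mult m_assoc)
  qed
  \<comment> \<open>Summing over \<open>i\<close> turns the first terms into
    \<open>e j \<otimes> d\<close> and, as the idempotents sum to \<open>\<one>\<close>, the second
    ones into \<open>e j \<otimes> \<Theta> (e j)\<close>.\<close>
  then have "(\<Oplus>i\<in>I. e j \<otimes> (\<Theta> (e i) \<otimes> e i) \<oplus> e j \<otimes> \<Theta> (e j) \<otimes> e i) = \<zero>"
    using j by (intro add.finprod_one_eqI) auto
  then have 2: "e j \<otimes> ?d \<oplus> e j \<otimes> \<Theta> (e j) = \<zero>"
    using j by (simp add: finsum_addf Pi_def sum_right_e finsum_rdistr [OF finite_I])
  let ?z = "\<Theta> (e j)"
  have "?z \<oplus> (e j \<otimes> ?d \<oplus> ?f \<otimes> e j) = (?d \<otimes> e j \<oplus> e j \<otimes> ?z) \<oplus> (e j \<otimes> ?d \<oplus> ?f \<otimes> e j)"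
    using idempotent_sum(1) [OF assms j] 1 by simp
  also have "\<dots> = (?d \<oplus> ?f) \<otimes> e j \<oplus> (e j \<otimes> ?d \<oplus> e j \<otimes> ?z)"
    using d f j by (simp add: l_distr a_ac del: add.inv_closed)
  finally show "?z \<oplus> (e j \<otimes> ?d \<oplus> ?f \<otimes> e j) = \<zero>"
    using 2 df j by simp
qed

end

text \<open>Here \<open>f\<close> is \<open>- d\<close>: without subtraction, AC rewriting settles the ring identities.\<close>

lemma (in jordan_map) jordan_add_commutator:
  assumes d: "d \<in> carrier A" and f: "f \<in> carrier A" and df: "d \<oplus> f = \<zero>"
  shows "jordan_map A (\<lambda>x. \<Theta> x \<oplus> (x \<otimes> d \<oplus> f \<otimes> x))"
proof
  let ?T = "\<lambda>x. \<Theta> x \<oplus> (x \<otimes> d \<oplus> f \<otimes> x)"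
  show "jordan_derivation A ?T"
    unfolding jordan_derivation_def linear_endo_def jordan_product_def
  proof (intro conjI ballI allI)
    show "?T \<in> carrier A \<rightarrow> carrier A"
      using d f by simp
  next
    fix x y assume xy: "x \<in> carrier A" "y \<in> carrier A"
    show "?T (x \<oplus> y) = ?T x \<oplus> ?T y"
      using xy d f by (simp add: Theta_add l_distr r_distr a_ac)
    \<comment> \<open>The terms with \<open>d\<close> or \<open>f\<close> in the middle are the ones
      that do not come from \<open>?T\<close> of the Jordan product; they cancel in pairs.\<close>
    have zero: "u \<otimes> d \<otimes> v \<oplus> u \<otimes> f \<otimes> v = \<zero>" if "u \<in> carrier A" "v \<in> carrier A" for u v
      using that d f df by (simp flip: l_distr r_distr)
    have "?T x \<otimes> y \<oplus> y \<otimes> ?T x \<oplus> (x \<otimes> ?T y \<oplus> ?T y \<otimes> x) =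
        ?T (x \<otimes> y \<oplus> y \<otimes> x) \<oplus> (x \<otimes> d \<otimes> y \<oplus> x \<otimes> f \<otimes> y) \<oplus> (y \<otimes> d \<otimes> x \<oplus> y \<otimes> f \<otimes> x)"
      using xy d f by (simp add: Theta_jordan l_distr r_distr m_assoc a_ac)
    then show "?T (x \<otimes> y \<oplus> y \<otimes> x) = ?T x \<otimes> y \<oplus> y \<otimes> ?T x \<oplus> (x \<otimes> ?T y \<oplus> ?T y \<otimes> x)"
      using xy d f by (simp add: zero)
  next
    fix k x assume x: "x \<in> carrier A"
    then show "?T (k \<odot> x) = k \<odot> ?T x"
      using d f by (simp add: Theta_smult smult_r_distr smult_mult_left smult_mult_right)
  qed
qed

text \<open>The corrected map \<open>?T\<close> kills all idempotents, so it satisfies the Leibniz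
  rule. It differs from \<open>\<Theta>\<close> by an inner derivation, whose contribution
  \<open>?c\<close> to \<open>x \<otimes> y\<close> cancels.\<close>

lemma (in triangular_algebra) jordan_derivation_imp_derivation:
  assumes two: "(2::'k) \<noteq> 0" and "jordan_derivation A \<Theta>"
  shows "derivation A \<Theta>"
proof -
  interpret triangular_jordan_map A I e \<Theta>
    by unfold_locales fact
  obtain d f where d: "d \<in> carrier A" and f: "f \<in> carrier A" and df: "d \<oplus> f = \<zero>"
    and kill: "\<And>j. j \<in> I \<Longrightarrow> \<Theta> (e j) \<oplus> (e j \<otimes> d \<oplus> f \<otimes> e j) = \<zero>"
    using ex_commutator [OF two] by blast
  let ?T = "\<lambda>x. \<Theta> x \<oplus> (x \<otimes> d \<oplus> f \<otimes> x)"
  interpret T: jordan_map A ?T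
    by (rule jordan_add_commutator [OF d f df])
  interpret T: triangular_jordan_map A I e ?T ..
  have "\<Theta> (x \<otimes> y) = \<Theta> x \<otimes> y \<oplus> x \<otimes> \<Theta> y" if xy: "x \<in> carrier A" "y \<in> carrier A" for x y
  proof -
    let ?c = "x \<otimes> y \<otimes> d \<oplus> f \<otimes> (x \<otimes> y)"
    have zero: "x \<otimes> d \<otimes> y \<oplus> x \<otimes> f \<otimes> y = \<zero>"
      using xy d f df by (simp flip: l_distr r_distr)
    have "\<Theta> (x \<otimes> y) \<oplus> ?c = ?T x \<otimes> y \<oplus> x \<otimes> ?T y"
      by (rule T.derivation_of_kill_idempotents [OF kill xy])
    also have "\<dots> = (\<Theta> x \<otimes> y \<oplus> x \<otimes> \<Theta> y) \<oplus> ?c \<oplus> (x \<otimes> d \<otimes> y \<oplus> x \<otimes> f \<otimes> y)"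
      using xy d f by (simp add: l_distr r_distr m_assoc a_ac)
    finally have "\<Theta> (x \<otimes> y) \<oplus> ?c = (\<Theta> x \<otimes> y \<oplus> x \<otimes> \<Theta> y) \<oplus> ?c"
      using xy d f by (simp add: zero)
    then show ?thesis
      using xy d f by (simp add: add.right_cancel)
  qed
  then show ?thesis
    using jordan by (simp add: derivation_def jordan_derivation_def)
qed


section \<open>Quotient algebras\<close>

context field_algebra
begin

context
  fixes J
  assumes J: "ideal J A"
begin

interpretation J: ideal J A
  by (rule J)

lemma quotient_carrier: "carrier (quotient_algebra A J) = (+>) J ` carrier A"
  by (auto simp: quotient_algebra_def FactRing_def A_RCOSETS_def' ring.defs module.defs)

lemma quotient_zero: "\<zero>\<^bsub>quotient_algebra A J\<^esub> = J +> \<zero>"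
  by (simp add: quotient_algebra_def FactRing_def ring.defs module.defs J.a_rcos_const)

lemma quotient_one: "\<one>\<^bsub>quotient_algebra A J\<^esub> = J +> \<one>"
  by (simp add: quotient_algebra_def FactRing_def ring.defs module.defs)

lemma quotient_add: "\<lbrakk>x \<in> carrier A; y \<in> carrier A\<rbrakk> \<Longrightarrow>
    (J +> x) \<oplus>\<^bsub>quotient_algebra A J\<^esub> (J +> y) = J +> (x \<oplus> y)"
  by (simp add: quotient_algebra_def FactRing_def ring.defs module.defs J.a_rcos_sum)

lemma quotient_mult: "\<lbrakk>x \<in> carrier A; y \<in> carrier A\<rbrakk> \<Longrightarrow>
    (J +> x) \<otimes>\<^bsub>quotient_algebra A J\<^esub> (J +> y) = J +> (x \<otimes> y)"
  by (simp add: quotient_algebra_def FactRing_def ring.defs module.defs J.rcoset_mult_add)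

text \<open>A ring ideal is automatically a subspace, because scaling by \<open>k\<close> is
  multiplication by \<open>k \<odot> \<one>\<close>. This makes the induced scalar action well
  defined.\<close>

lemma ideal_smult_closed:
  assumes "h \<in> J"
  shows "k \<odot> h \<in> J"
proof -
  have "k \<odot> h = (k \<odot> \<one>) \<otimes> h"
    using J.Icarr [OF assms] by (simp add: smult_mult_left)
  then show ?thesis
    using J.I_l_closed [OF assms, of "k \<odot> \<one>"] by simp
qed

lemma quotient_smult:
  assumes x: "x \<in> carrier A"
  shows "k \<odot>\<^bsub>quotient_algebra A J\<^esub> (J +> x) = J +> (k \<odot> x)"
proof -
  have "J +> (k \<odot> y) = J +> (k \<odot> x)" if y: "y \<in> J +> x" for y
  proof -
    obtain h where h: "h \<in> J" "y = h \<oplus> x"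
      using y by (auto simp: a_r_coset_def')
    then have "k \<odot> y = k \<odot> h \<oplus> k \<odot> x"
      using x J.Icarr by (simp add: smult_r_distr)
    then have "k \<odot> y \<in> J +> (k \<odot> x)"
      using ideal_smult_closed [OF h(1)] by (auto simp: a_r_coset_def')
    then show ?thesis
      using J.a_repr_independence' x by auto
  qed
  \<comment> \<open>All cosets in the union coincide; the union is that coset because it ranges over
    a nonempty set.\<close>
  moreover have "x \<in> J +> x"
    by (rule J.a_rcos_self [OF x])
  ultimately have "(\<Union>y\<in>J +> x. J +> (k \<odot> y)) = J +> (k \<odot> x)"
    by blast
  then show ?thesis
    by (simp add: quotient_algebra_def ring.defs module.defs)
qed

lemmas quotient_ops = quotient_zero quotient_one quotient_add quotient_mult quotient_smult

lemma field_algebra_quotient: "field_algebra (quotient_algebra A J)"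
proof -
  let ?Q = "quotient_algebra A J"
  have "ring ?Q"
  proof (intro ringI abelian_groupI monoidI)
    fix X assume "X \<in> carrier ?Q"
    then obtain x where "x \<in> carrier A" "X = J +> x"
      by (auto simp: quotient_carrier)
    then show "\<exists>Y\<in>carrier ?Q. Y \<oplus>\<^bsub>?Q\<^esub> X = \<zero>\<^bsub>?Q\<^esub>"
      by (intro bexI [of _ "J +> (\<ominus> x)"]) (auto simp: quotient_carrier quotient_ops l_neg)
  qed (auto simp: quotient_carrier quotient_ops m_assoc a_ac l_distr r_distr)
  then interpret Q: ring ?Q .
  show ?thesis
    by unfold_locales (auto simp: quotient_carrier quotient_ops smult_l_distr smult_r_distr
        smult_assoc smult_mult_left smult_mult_right)
qed

lemma finsum_quotient:
  assumes "finite I" "\<And>i. i \<in> I \<Longrightarrow> f i \<in> carrier A"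
  shows "finsum (quotient_algebra A J) (\<lambda>i. J +> f i) I = J +> finsum A f I"
proof -
  interpret Q: field_algebra "quotient_algebra A J"
    by (rule field_algebra_quotient)
  from assms show ?thesis
  proof (induction I rule: finite_induct)
    case empty
    show ?case by (simp add: quotient_zero)
  next
    case (insert i I)
    then have "f \<in> I \<rightarrow> carrier A" "f i \<in> carrier A" "finsum A f I \<in> carrier A"
      by auto
    then show ?case
      using insert by (simp add: Q.finsum_insert quotient_carrier Pi_def quotient_add)
  qed
qed

end

end

text \<open>Each axiom is checked on representatives and projected. It stays valid even if some
  \<open>e i\<close> lies in \<open>J\<close>.\<close>

lemma (in triangular_algebra) triangular_quotient:
  assumes J: "ideal J A"
  shows "triangular_algebra (quotient_algebra A J) I (\<lambda>i. J +> e i)"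
proof -
  let ?Q = "quotient_algebra A J"
  note ops = quotient_ops [OF J]
  interpret Q: field_algebra ?Q
    by (rule field_algebra_quotient [OF J])
  show ?thesis
  proof
    fix i X assume i: "i \<in> I" and "X \<in> carrier ?Q"
    then obtain x where x: "x \<in> carrier A" "X = J +> x"
      by (auto simp: quotient_carrier [OF J])
    with corner [OF i x(1)] obtain k where "e i \<otimes> x \<otimes> e i = k \<odot> e i"
      by blast
    then show "\<exists>k. (J +> e i) \<otimes>\<^bsub>?Q\<^esub> X \<otimes>\<^bsub>?Q\<^esub> (J +> e i) = k \<odot>\<^bsub>?Q\<^esub> (J +> e i)"
      using i x by (auto simp: ops)
  next
    fix i j X Y
    assume ij: "i \<in> I" "j \<in> I" "i \<noteq> j" and "X \<in> carrier ?Q" "Y \<in> carrier ?Q"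
    then obtain x y where "x \<in> carrier A" "X = J +> x" "y \<in> carrier A" "Y = J +> y"
      by (auto simp: quotient_carrier [OF J])
    then show "(J +> e i) \<otimes>\<^bsub>?Q\<^esub> X \<otimes>\<^bsub>?Q\<^esub> (J +> e j) = \<zero>\<^bsub>?Q\<^esub> \<or>
        (J +> e j) \<otimes>\<^bsub>?Q\<^esub> Y \<otimes>\<^bsub>?Q\<^esub> (J +> e i) = \<zero>\<^bsub>?Q\<^esub>"
      using ij triangular [OF ij, of x y] by (auto simp: ops)
  next
    show "(\<Oplus>\<^bsub>?Q\<^esub>i\<in>I. J +> e i) = \<one>\<^bsub>?Q\<^esub>"
      using finite_I by (simp add: finsum_quotient [OF J] sum_e ops)
  qed (auto simp: quotient_carrier [OF J] ops finite_I e_mult)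
qed


section \<open>Path algebras of acyclic quivers\<close>

lemma poly_mapping_sum_single:
  fixes x :: "'a \<Rightarrow>\<^sub>0 'b::comm_monoid_add"
  shows "(\<Sum>p\<in>Poly_Mapping.keys x. Poly_Mapping.single p (Poly_Mapping.lookup x p)) = x"
  by (rule poly_mapping_eqI)
    (auto simp: lookup_sum lookup_single when_def in_keys_iff sum.delta)

text \<open>Isolates one summand of the product, with its coefficient as an argument, so that
  bilinearity reduces to additivity in \<open>c\<close>.\<close>

definition path_term :: "('v, 'e) qpath \<Rightarrow> ('v, 'e) qpath \<Rightarrow> 'k::field \<Rightarrow> ('v, 'e) qpath \<Rightarrow>\<^sub>0 'k" where
  "path_term p q c =
    (if path_end q = path_start p then Poly_Mapping.single (path_concat p q) c else 0)"

lemma path_term_zero [simp]: "path_term p q 0 = 0"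
  and path_term_add: "path_term p q (c + d) = path_term p q c + path_term p q d"
  by (simp_all add: path_term_def single_add)

text \<open>Pairs outside the supports contribute zero. Additivity requires this freedom:
  cancellation can make the support of \<open>x + y\<close> smaller than the union of the supports,
  so a common index set is chosen.\<close>

lemma path_algebra_mult_eq:
  assumes "finite S" "Poly_Mapping.keys x \<subseteq> S" "finite T" "Poly_Mapping.keys y \<subseteq> T"
  shows "path_algebra_mult x y =
    (\<Sum>p\<in>S. \<Sum>q\<in>T. path_term p q (Poly_Mapping.lookup x p * Poly_Mapping.lookup y q))"
proof -
  have "path_algebra_mult x y = (\<Sum>p\<in>Poly_Mapping.keys x. \<Sum>q\<in>T.
      path_term p q (Poly_Mapping.lookup x p * Poly_Mapping.lookup y q))"
    unfolding path_algebra_mult_def path_term_def [symmetric]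
    using assms by (intro sum.cong sum.mono_neutral_left) (auto simp: in_keys_iff)
  also have "\<dots> = (\<Sum>p\<in>S. \<Sum>q\<in>T.
      path_term p q (Poly_Mapping.lookup x p * Poly_Mapping.lookup y q))"
    using assms by (intro sum.mono_neutral_left) (auto simp: in_keys_iff)
  finally show ?thesis .
qed

lemma path_algebra_mult_add_left:
  "path_algebra_mult (x + y) z = path_algebra_mult x z + path_algebra_mult y z"
proof -
  let ?S = "Poly_Mapping.keys x \<union> Poly_Mapping.keys y" and ?T = "Poly_Mapping.keys z"
  have "Poly_Mapping.keys (x + y) \<subseteq> ?S"
    by (rule Poly_Mapping.keys_add)
  then show ?thesis
    by (simp add: path_algebra_mult_eq [where S = ?S and T = ?T] lookup_add path_term_add
        distrib_right sum.distrib)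
qed

lemma path_algebra_mult_add_right:
  "path_algebra_mult x (y + z) = path_algebra_mult x y + path_algebra_mult x z"
proof -
  let ?S = "Poly_Mapping.keys x" and ?T = "Poly_Mapping.keys y \<union> Poly_Mapping.keys z"
  have "Poly_Mapping.keys (y + z) \<subseteq> ?T"
    by (rule Poly_Mapping.keys_add)
  then show ?thesis
    by (simp add: path_algebra_mult_eq [where S = ?S and T = ?T] lookup_add path_term_add
        distrib_left sum.distrib)
qed

lemma path_algebra_mult_zero [simp]:
  "path_algebra_mult 0 x = 0" "path_algebra_mult x 0 = 0"
  by (simp_all add: path_algebra_mult_def)

lemma path_algebra_mult_sum_left:
  "path_algebra_mult (sum f I) x = (\<Sum>i\<in>I. path_algebra_mult (f i) x)"
  by (induction I rule: infinite_finite_induct) (simp_all add: path_algebra_mult_add_left)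

lemma path_algebra_mult_sum_right:
  "path_algebra_mult x (sum f I) = (\<Sum>i\<in>I. path_algebra_mult x (f i))"
  by (induction I rule: infinite_finite_induct) (simp_all add: path_algebra_mult_add_right)

lemma path_algebra_mult_single:
  "path_algebra_mult (Poly_Mapping.single p c) (Poly_Mapping.single q d) = path_term p q (c * d)"
  by (subst path_algebra_mult_eq [where S = "{p}" and T = "{q}"]) auto

text \<open>Restricting the first case to \<open>p\<close> in the support of \<open>x\<close>
  preserves the information that only paths of the quiver occur, as the identity laws
  require.\<close>

lemma poly_mapping_single_induct [case_names single add zero]:
  fixes x :: "'a \<Rightarrow>\<^sub>0 'b::comm_monoid_add"
  assumes "\<And>p c. p \<in> Poly_Mapping.keys x \<Longrightarrow> P (Poly_Mapping.single p c)"
    and "\<And>x y. P x \<Longrightarrow> P y \<Longrightarrow> P (x + y)" and "P 0"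
  shows "P x"
proof -
  have "P (\<Sum>p\<in>S. Poly_Mapping.single p (Poly_Mapping.lookup x p))"
    if "finite S" "S \<subseteq> Poly_Mapping.keys x" for S
    using that by (induction S rule: finite_induct) (auto intro: assms)
  from this [OF finite_keys order_refl] show ?thesis
    by (simp add: poly_mapping_sum_single)
qed

text \<open>By additivity in each argument only single paths matter. For these, both sides are the
  triple concatenation if the ends match, and zero otherwise.\<close>

lemma path_algebra_mult_assoc:
  "path_algebra_mult (path_algebra_mult x y) z = path_algebra_mult x (path_algebra_mult y z)"
proof (induction x rule: poly_mapping_single_induct)
  case (single p a)
  show ?case
  proof (induction y rule: poly_mapping_single_induct)
    case (single q b)
    show ?case
    proof (induction z rule: poly_mapping_single_induct)
      case (single r c)
      show ?case
        by (auto simp: path_algebra_mult_single path_term_def path_concat_def path_start_def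
            path_end_def path_arrows_def mult.assoc)
    qed (simp_all add: path_algebra_mult_add_right)
  qed (simp_all add: path_algebra_mult_add_left path_algebra_mult_add_right)
qed (simp_all add: path_algebra_mult_add_left)

lemma lookup_scale [simp]:
  fixes x :: "'a \<Rightarrow>\<^sub>0 'k::field"
  shows "Poly_Mapping.lookup (Poly_Mapping.map ((*) k) x) p = k * Poly_Mapping.lookup x p"
  by (simp add: map.rep_eq when_def)

lemma scale_add:
  fixes x y :: "'a \<Rightarrow>\<^sub>0 'k::field"
  shows "Poly_Mapping.map ((*) k) (x + y) = Poly_Mapping.map ((*) k) x + Poly_Mapping.map ((*) k) y"
  by (rule poly_mapping_eqI) (simp add: lookup_add distrib_left)

lemma scale_single [simp]:
  fixes c :: "'k::field"
  shows "Poly_Mapping.map ((*) k) (Poly_Mapping.single p c) = Poly_Mapping.single p (k * c)"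
  by (rule poly_mapping_eqI) (simp add: lookup_single when_def)

lemma scale_zero [simp]: "Poly_Mapping.map ((*) (k::'k::field)) 0 = 0"
  by (rule poly_mapping_eqI) simp

lemma keys_scale:
  fixes x :: "'a \<Rightarrow>\<^sub>0 'k::field"
  shows "Poly_Mapping.keys (Poly_Mapping.map ((*) k) x) \<subseteq> Poly_Mapping.keys x"
  by (auto simp: in_keys_iff)

lemma scale_path_term: "Poly_Mapping.map ((*) k) (path_term p q c) = path_term p q (k * c)"
  by (simp add: path_term_def)

lemma path_algebra_mult_scale_left:
  "path_algebra_mult (Poly_Mapping.map ((*) k) x) y =
    Poly_Mapping.map ((*) k) (path_algebra_mult x y)"
proof (induction x rule: poly_mapping_single_induct)
  case (single p a)
  show ?case
  proof (induction y rule: poly_mapping_single_induct)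
    case (single q b)
    show ?case
      by (simp add: path_algebra_mult_single scale_path_term mult.assoc)
  qed (simp_all add: path_algebra_mult_add_right scale_add)
qed (simp_all add: path_algebra_mult_add_left scale_add)

lemma path_algebra_mult_scale_right:
  "path_algebra_mult x (Poly_Mapping.map ((*) k) y) =
    Poly_Mapping.map ((*) k) (path_algebra_mult x y)"
proof (induction x rule: poly_mapping_single_induct)
  case (single p a)
  show ?case
  proof (induction y rule: poly_mapping_single_induct)
    case (single q b)
    show ?case
      by (simp add: path_algebra_mult_single scale_path_term mult.left_commute)
  qed (simp_all add: path_algebra_mult_add_right scale_add)
qed (simp_all add: path_algebra_mult_add_left scale_add)

text \<open>In general only an inclusion: different pairs may concatenate to the same path and their
  coefficients may cancel.\<close>

lemma keys_path_algebra_mult: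
  "Poly_Mapping.keys (path_algebra_mult x y) \<subseteq>
    {path_concat p q | p q. p \<in> Poly_Mapping.keys x \<and> q \<in> Poly_Mapping.keys y \<and>
      path_end q = path_start p}"
proof
  fix r assume "r \<in> Poly_Mapping.keys (path_algebra_mult x y)"
  then obtain p where p: "p \<in> Poly_Mapping.keys x"
    and "r \<in> Poly_Mapping.keys (\<Sum>q\<in>Poly_Mapping.keys y.
      path_term p q (Poly_Mapping.lookup x p * Poly_Mapping.lookup y q))"
    unfolding path_algebra_mult_def path_term_def by (blast dest: subsetD [OF Poly_Mapping.keys_sum])
  then obtain q where q: "q \<in> Poly_Mapping.keys y"
    and "r \<in> Poly_Mapping.keys (path_term p q (Poly_Mapping.lookup x p * Poly_Mapping.lookup y q))"
    by (blast dest: subsetD [OF Poly_Mapping.keys_sum])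
  then have "path_end q = path_start p" "r = path_concat p q"
    by (auto simp: path_term_def split: if_splits)
  with p q show "r \<in> {path_concat p q | p q. p \<in> Poly_Mapping.keys x \<and>
      q \<in> Poly_Mapping.keys y \<and> path_end q = path_start p}"
    by blast
qed

lemma path_concat_simps [simp]:
  "path_start (path_concat p q) = path_start q"
  "path_end (path_concat p q) = path_end p"
  "path_arrows (path_concat p q) = path_arrows q @ path_arrows p"
  by (simp_all add: path_concat_def path_start_def path_end_def path_arrows_def)

lemma trivial_path_simps [simp]:
  "path_start (trivial_path i) = i" "path_end (trivial_path i) = i"
  "path_arrows (trivial_path i) = []"
  by (simp_all add: trivial_path_def path_start_def path_end_def path_arrows_def)

lemma path_eqI:
  "\<lbrakk>path_start p = path_start q; path_arrows p = path_arrows q; path_end p = path_end q\<rbrakk> \<Longrightarrow> p = q"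
  by (simp add: path_start_def path_end_def path_arrows_def prod_eq_iff)

lemma path_concat_trivial:
  "path_concat (trivial_path (path_end p)) p = p" "path_concat p (trivial_path (path_start p)) = p"
  by (rule path_eqI; simp)+

section \<open>The path algebra of a quiver\<close>

context wf_digraph
begin

lemma trivial_path_in_qpaths [simp]: "i \<in> verts G \<Longrightarrow> trivial_path i \<in> qpaths G"
  by (simp add: qpaths_def awalk_Nil_iff)

lemma path_concat_in_qpaths:
  "\<lbrakk>p \<in> qpaths G; q \<in> qpaths G; path_end q = path_start p\<rbrakk> \<Longrightarrow> path_concat p q \<in> qpaths G"
  using awalk_appendI by (auto simp: qpaths_def)

lemma path_ends_in_verts:
  assumes "p \<in> qpaths G"
  shows "path_start p \<in> verts G" "path_end p \<in> verts G"
  using assms awalk_hd_in_verts awalk_last_in_verts by (auto simp: qpaths_def)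

text \<open>On a single path, exactly one trivial path survives: the one at its end on the left, the
  one at its start on the right. Both ends are vertices, so the sum contains it.\<close>

lemma path_algebra_mult_one:
  assumes "finite (verts G)" and x: "Poly_Mapping.keys x \<subseteq> qpaths G"
  shows "path_algebra_mult (\<Sum>i\<in>verts G. Poly_Mapping.single (trivial_path i) 1) x = x"
    and "path_algebra_mult x (\<Sum>i\<in>verts G. Poly_Mapping.single (trivial_path i) 1) = x"
proof -
  show "path_algebra_mult (\<Sum>i\<in>verts G. Poly_Mapping.single (trivial_path i) 1) x = x"
  proof (induction x rule: poly_mapping_single_induct)
    case (single p c)
    then have "path_end p \<in> verts G"
      using x path_ends_in_verts by blast
    then show ?case
      using assms(1) by (simp add: path_algebra_mult_sum_left path_algebra_mult_single path_term_def
          sum.delta' path_concat_trivial cong: if_cong)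
  qed (simp_all add: path_algebra_mult_add_right)
  show "path_algebra_mult x (\<Sum>i\<in>verts G. Poly_Mapping.single (trivial_path i) 1) = x"
  proof (induction x rule: poly_mapping_single_induct)
    case (single p c)
    then have "path_start p \<in> verts G"
      using x path_ends_in_verts by blast
    then show ?case
      using assms(1) by (simp add: path_algebra_mult_sum_right path_algebra_mult_single path_term_def
          sum.delta path_concat_trivial cong: if_cong)
  qed (simp_all add: path_algebra_mult_add_left)
qed

lemma path_algebra_mult_closed:
  assumes "Poly_Mapping.keys x \<subseteq> qpaths G" "Poly_Mapping.keys y \<subseteq> qpaths G"
  shows "Poly_Mapping.keys (path_algebra_mult x y) \<subseteq> qpaths G"
  using assms path_concat_in_qpaths by (fastforce dest: subsetD [OF keys_path_algebra_mult])

lemma ring_path_algebra: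
  assumes "finite (verts G)"
  shows "ring (path_algebra G :: ('k::field, _) module)"
proof (intro ringI abelian_groupI monoidI)
  let ?A = "path_algebra G :: ('k, _) module"
  fix x assume "x \<in> carrier ?A"
  then show "\<exists>y\<in>carrier ?A. y \<oplus>\<^bsub>?A\<^esub> x = \<zero>\<^bsub>?A\<^esub>"
    by (intro bexI [of _ "- x"]) (auto simp: path_algebra_def in_keys_iff)
next
  let ?A = "path_algebra G :: ('k, _) module"
  show "\<one>\<^bsub>?A\<^esub> \<in> carrier ?A"
    by (auto simp: path_algebra_def dest!: subsetD [OF Poly_Mapping.keys_sum])
qed (auto simp: path_algebra_def add_ac path_algebra_mult_assoc path_algebra_mult_add_left
    path_algebra_mult_add_right path_algebra_mult_one assms
    dest: subsetD [OF Poly_Mapping.keys_add] subsetD [OF path_algebra_mult_closed, rotated -1])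

lemma field_algebra_path_algebra:
  assumes "finite (verts G)"
  shows "field_algebra (path_algebra G :: ('k::field, _) module)"
proof -
  let ?A = "path_algebra G :: ('k, _) module"
  interpret ring ?A
    by (rule ring_path_algebra [OF assms])
  show ?thesis
  proof
    show "k \<odot>\<^bsub>?A\<^esub> x \<in> carrier ?A" if "x \<in> carrier ?A" for k x
      using that subset_trans [OF keys_scale] by (simp add: path_algebra_def)
  qed (auto simp: path_algebra_def scale_add path_algebra_mult_scale_left
      path_algebra_mult_scale_right lookup_add algebra_simps intro!: poly_mapping_eqI)
qed

lemma finsum_path_algebra:
  fixes f :: "'i \<Rightarrow> ('a, 'b) qpath \<Rightarrow>\<^sub>0 'k::field"
  assumes "finite (verts G)" "finite I" "\<And>i. i \<in> I \<Longrightarrow> f i \<in> carrier (path_algebra G)"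
  shows "finsum (path_algebra G) f I = sum f I"
proof -
  interpret ring "path_algebra G :: ('k, _) module"
    by (rule ring_path_algebra [OF assms(1)])
  from assms(2,3) show ?thesis
  proof (induction I rule: finite_induct)
    case empty
    show ?case by (simp only: finsum_empty sum.empty) (simp add: path_algebra_def)
  next
    case (insert i I)
    then show ?case
      by (subst finsum_insert) (auto simp: path_algebra_def)
  qed
qed

text \<open>The left factor is traversed last, so the component at \<open>(i, j)\<close> is
  supported on paths from \<open>j\<close> to \<open>i\<close>.\<close>

lemma keys_corner:
  fixes x :: "('a, 'b) qpath \<Rightarrow>\<^sub>0 'k::field"
  assumes "p \<in> Poly_Mapping.keys (path_algebra_mult (path_algebra_mult
      (Poly_Mapping.single (trivial_path i) 1) x) (Poly_Mapping.single (trivial_path j) 1))"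
  shows "p \<in> Poly_Mapping.keys x \<and> path_start p = j \<and> path_end p = i"
proof -
  obtain q where q: "q \<in> Poly_Mapping.keys (path_algebra_mult
      (Poly_Mapping.single (trivial_path i) (1::'k)) x)"
    and "path_start q = j" "p = path_concat q (trivial_path j)"
    using subsetD [OF keys_path_algebra_mult assms] by auto
  moreover obtain r where "r \<in> Poly_Mapping.keys x" "path_end r = i"
    "q = path_concat (trivial_path i) r"
    using subsetD [OF keys_path_algebra_mult q] by auto
  ultimately show ?thesis
    using path_concat_trivial by metis
qed

text \<open>A closed path is trivial, which gives \<open>corner\<close>. Nonzero elements in two
  opposite off-diagonal components would supply paths in both directions between distinct vertices,
  and their concatenation would be an oriented cycle.\<close>

lemma triangular_path_algebra:
  assumes "finite (verts G)" and acyclic: "\<nexists>p. oriented_cycle G p"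
  shows "triangular_algebra (path_algebra G :: ('k::field, _) module) (verts G)
    (\<lambda>i. Poly_Mapping.single (trivial_path i) 1)"
proof -
  let ?A = "path_algebra G :: ('k, _) module"
  let ?e = "\<lambda>i. Poly_Mapping.single (trivial_path i) (1::'k) :: ('a, 'b) qpath \<Rightarrow>\<^sub>0 'k"
  interpret field_algebra ?A
    by (rule field_algebra_path_algebra [OF assms(1)])
  have mult: "x \<otimes>\<^bsub>?A\<^esub> y = path_algebra_mult x y" for x y
    by (simp add: path_algebra_def)
  show ?thesis
  proof
    fix i assume i: "i \<in> verts G"
    then show "?e i \<in> carrier ?A"
      by (simp add: path_algebra_def)
    fix x assume x: "x \<in> carrier ?A"
    have "Poly_Mapping.keys (?e i \<otimes>\<^bsub>?A\<^esub> x \<otimes>\<^bsub>?A\<^esub> ?e i) \<subseteq> {trivial_path i}"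
    proof
      fix p assume "p \<in> Poly_Mapping.keys (?e i \<otimes>\<^bsub>?A\<^esub> x \<otimes>\<^bsub>?A\<^esub> ?e i)"
      then have p: "p \<in> Poly_Mapping.keys x" "path_start p = i" "path_end p = i"
        using keys_corner [of p i x i] by (simp_all add: mult)
      then have "p \<in> qpaths G"
        using x by (auto simp: path_algebra_def)
      then have "path_arrows p = []"
        using acyclic p unfolding oriented_cycle_def by metis
      then show "p \<in> {trivial_path i}"
        using p by (auto intro: path_eqI)
    qed
    \<comment> \<open>The scalar is the coefficient at the trivial path, the only possible
      support.\<close>
    then have "?e i \<otimes>\<^bsub>?A\<^esub> x \<otimes>\<^bsub>?A\<^esub> ?e i =
        Poly_Mapping.lookup (?e i \<otimes>\<^bsub>?A\<^esub> x \<otimes>\<^bsub>?A\<^esub> ?e i) (trivial_path i) \<odot>\<^bsub>?A\<^esub> ?e i"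
      by (intro poly_mapping_eqI) (auto simp: path_algebra_def lookup_single when_def in_keys_iff)
    then show "\<exists>k. ?e i \<otimes>\<^bsub>?A\<^esub> x \<otimes>\<^bsub>?A\<^esub> ?e i = k \<odot>\<^bsub>?A\<^esub> ?e i"
      by blast
  next
    fix i j assume "i \<in> verts G" "j \<in> verts G"
    then show "?e i \<otimes>\<^bsub>?A\<^esub> ?e j = (if i = j then ?e i else \<zero>\<^bsub>?A\<^esub>)"
      using path_concat_trivial(1) [of "trivial_path i :: ('a, 'b) qpath"]
      by (auto simp: path_algebra_def path_algebra_mult_single path_term_def)
  next
    show "finsum ?A ?e (verts G) = \<one>\<^bsub>?A\<^esub>"
      using assms(1) by (subst finsum_path_algebra) (simp_all add: path_algebra_def)
  next
    fix i j x y
    assume "i \<in> verts G" "j \<in> verts G" and ij: "i \<noteq> j" and xy: "x \<in> carrier ?A" "y \<in> carrier ?A"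
    show "?e i \<otimes>\<^bsub>?A\<^esub> x \<otimes>\<^bsub>?A\<^esub> ?e j = \<zero>\<^bsub>?A\<^esub> \<or> ?e j \<otimes>\<^bsub>?A\<^esub> y \<otimes>\<^bsub>?A\<^esub> ?e i = \<zero>\<^bsub>?A\<^esub>"
    proof (rule ccontr)
      assume "\<not> ?thesis"
      moreover have "\<exists>p. p \<in> Poly_Mapping.keys z" if "z \<noteq> \<zero>\<^bsub>?A\<^esub>" for z
        using that by (simp add: path_algebra_def ex_in_conv del: split_paired_Ex)
      ultimately obtain p q where "p \<in> Poly_Mapping.keys (?e i \<otimes>\<^bsub>?A\<^esub> x \<otimes>\<^bsub>?A\<^esub> ?e j)"
        "q \<in> Poly_Mapping.keys (?e j \<otimes>\<^bsub>?A\<^esub> y \<otimes>\<^bsub>?A\<^esub> ?e i)"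
        by blast
      then have p: "p \<in> qpaths G" "path_start p = j" "path_end p = i"
        and q: "q \<in> qpaths G" "path_start q = i" "path_end q = j"
        using keys_corner [of p i x j] keys_corner [of q j y i] xy
        by (auto simp: path_algebra_def)
      \<comment> \<open>Distinct end vertices make \<open>p\<close> nontrivial, hence also the
        closed path through \<open>i\<close>.\<close>
      have "path_arrows p \<noteq> []"
        using p ij by (auto simp: qpaths_def awalk_Nil_iff)
      then have "oriented_cycle G (path_concat p q)"
        using p q by (simp add: oriented_cycle_def path_concat_in_qpaths)
      then show False
        using acyclic by blast
    qed
  qed (rule assms(1))
qed

end

lemma two_neq_zero:
  assumes "CHAR('k::field) \<noteq> 2"
  shows "(2::'k) \<noteq> 0"
proof
  assume "(2::'k) = 0"
  then have "of_nat 2 = (0::'k)"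
    by simp
  then have *: "CHAR('k) dvd 2"
    by (simp only: of_nat_eq_0_iff_char_dvd)
  moreover from * have "CHAR('k) \<noteq> 0"
    by (intro notI) simp
  \<comment> \<open>A positive divisor of 2 other than 2 is 1, but in characteristic 1 the field
    would satisfy \<open>1 = 0\<close>.\<close>
  ultimately have "CHAR('k) = 1"
    using assms dvd_imp_le [OF *] by linarith
  then show False
    using of_nat_CHAR [where 'a = 'k] by simp
qed

theorem theorem3p4:
  fixes \<Gamma> :: "('v, 'e) pre_digraph"
    and \<rho> :: "(('v, 'e) qpath \<Rightarrow>\<^sub>0 'k::field) set"
  assumes "CHAR('k) \<noteq> 2"
    and "fin_digraph \<Gamma>"
    and "\<nexists>p. oriented_cycle \<Gamma> p"
    and "\<forall>r\<in>\<rho>. quiver_relation \<Gamma> r"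
  shows "\<forall>\<Theta>. jordan_derivation (path_algebra_relations \<Gamma> \<rho>) \<Theta>
    \<longrightarrow> derivation (path_algebra_relations \<Gamma> \<rho>) \<Theta>"
proof (intro allI impI)
  fix \<Theta> assume \<Theta>: "jordan_derivation (path_algebra_relations \<Gamma> \<rho>) \<Theta>"
  let ?A = "path_algebra \<Gamma> :: ('k, ('v, 'e) qpath \<Rightarrow>\<^sub>0 'k) module"
  interpret \<Gamma>: fin_digraph \<Gamma>
    by (rule assms(2))
  have two: "(2::'k) \<noteq> 0"
    by (rule two_neq_zero [OF assms(1)])
  interpret P: triangular_algebra ?A "verts \<Gamma>" "\<lambda>i. Poly_Mapping.single (trivial_path i) 1"
    by (rule \<Gamma>.triangular_path_algebra [OF \<Gamma>.finite_verts assms(3)])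
  \<comment> \<open>Relations are elements of the path algebra, so \<open>\<rho>\<close> generates
    an ideal there and the triangular structure descends to the quotient.\<close>
  have "\<rho> \<subseteq> carrier ?A"
    using assms(4) by (auto simp: quiver_relation_def)
  then have "ideal (Idl\<^bsub>?A\<^esub> \<rho>) ?A"
    by (rule P.genideal_ideal)
  from triangular_algebra.jordan_derivation_imp_derivation [OF P.triangular_quotient [OF this] two]
  show "derivation (path_algebra_relations \<Gamma> \<rho>) \<Theta>"
    using \<Theta> by (simp add: path_algebra_relations_def)
qed

end
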